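(* For each $n\in\mathbb{N}^+$ there is an infinite word $V\in\{0,1\}^{\mathbb{N}}$ which has a proper spacer rank-$(n+1)$ construction and no spacer rank-$n$ construction.
   Context: Conventions: $\mathbb{N}$ is the set of nonnegative integers, $\mathbb{N}^+$ the positive integers. A finite word is an element of $\bigcup_{m\ge 1}\{0,1\}^m$, with length $|w|$; an infinite word is an element of $\{0,1\}^{\mathbb{N}}$. Juxtaposition is concatenation and $1^a$ is $a$ consecutive $1$s ($1^0$ is empty). Building: let $\mathcal{F}$ be the set of all finite words that start and end with $0$, and let $S\subset\mathcal{F}$ be finite. A building of a finite word $w$ from $S$ is an expression $w=v_11^{a_1}v_21^{a_2}\cdots v_k1^{a_k}v_{k+1}$ with $k\ge 1$, all $v_i\in S$ and all $a_i\in\mathbb{N}$. Every word of $S$ is used in it if $\{v_1,\dots,v_{k+1}\}=S$. The word $w$ is built from $S$ if such a building exists, and built from $S$ starting with $u$ if there is one with $v_1=u$. At most spacer rank-$n$: an infinite word $V$ has an at most spacer rank-$n$ construction if there are finite sets $S_i=\{v_{i,1},\dots,v_{i,n_i}\}\subset\mathcal{F}$ ($i\in\mathbb{N}$) with $1\le n_i\le n$ such that: $v_{0,j}=0$ for all $j$; $v_{i+1,1}$ is built from $S_i$ starting with $v_{i,1}$; $v_{i+1,j}$ is built from $S_i$ for all $2\le j\le n_{i+1}$; and $v_{i,1}$ is an initial segment of $V$ for all $i$. Spacer rank-$n$: for $n>1$, $V$ has a spacer rank-$n$ construction if it has an at most spacer rank-$n$ construction and does not have an at most spacer rank-$(n-1)$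 construction; a spacer rank-$1$ construction is an at most spacer rank-$1$ construction. Proper spacer rank-$n$: $V$ has a proper spacer rank-$n$ construction if it does not have an at most spacer rank-$(n-1)$ construction (when $n>1$), and there are sets $S_i$ with $S_0=\{0\}$ and, for $i\ge 1$, $S_i=\{v_{i,1},\dots,v_{i,n}\}\subset\mathcal{F}$ a set of $n$ words, such that: $v_{0,j}=0$ for all $1\le j\le n$; for every $i\ge0$, $v_{i+1,1}$ is built from $S_i$ starting with $v_{i,1}$ and $v_{i+1,j}$ is built from $S_i$ for $2\le j\le n$; every word of $S_i$ is used in the building of $v_{i+1,j}$ for all $1\le j\le n$; and $v_{i,1}$ is an initial segment of $V$ for all $i\in\mathbb{N}$. *)

theory Defs
  imports Main "HOL-Library.Z2"
begin

text \<open>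
  Letters are elements of the two-element type \<open>bit\<close>, finite words are nonempty lists
  of letters, and infinite words are functions \<open>nat \<Rightarrow> bit\<close>.
\<close>

type_synonym word = "bit list"
type_synonym infinite_word = "nat \<Rightarrow> bit"

definition zero_words :: "word set"  (\<open>\<F>\<close>) where
  "\<F> = {w. w \<noteq> [] \<and> hd w = 0 \<and> last w = 0}"

text \<open>
  \<open>building S w vs as\<close> says that \<open>vs = [v\<^sub>1, \<dots>, v\<^sub>k\<^sub>+\<^sub>1]\<close> and \<open>as = [a\<^sub>1, \<dots>, a\<^sub>k]\<close>, with
  \<open>k \<ge> 1\<close>, form the building \<open>w = v\<^sub>1 1^a\<^sub>1 v\<^sub>2 1^a\<^sub>2 \<dots> v\<^sub>k 1^a\<^sub>k v\<^sub>k\<^sub>+\<^sub>1\<close> of \<open>w\<close> from \<open>S\<close>.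
\<close>

definition building :: "word set \<Rightarrow> word \<Rightarrow> word list \<Rightarrow> nat list \<Rightarrow> bool" where
  "building S w vs as \<longleftrightarrow>
     length as \<ge> 1 \<and> length vs = length as + 1 \<and> set vs \<subseteq> S \<and>
     w = concat (map2 (\<lambda>v a. v @ replicate a 1) (butlast vs) as) @ last vs"

definition built_from :: "word set \<Rightarrow> word \<Rightarrow> bool" where
  "built_from S w \<longleftrightarrow> (\<exists>vs as. building S w vs as)"

definition built_from_starting_with :: "word set \<Rightarrow> word \<Rightarrow> word \<Rightarrow> bool" where
  "built_from_starting_with S u w \<longleftrightarrow> (\<exists>vs as. building S w vs as \<and> hd vs = u)"

definition initial_segment :: "word \<Rightarrow> infinite_word \<Rightarrow> bool" where
  "initial_segment w V \<longleftrightarrow> (\<forall>m < length w. w ! m = V m)"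

text \<open>
  The enumeration \<open>v i 1, \<dots>, v i (N i)\<close> of \<open>S\<^sub>i\<close> may have repetitions.
\<close>

definition at_most_spacer_rank :: "nat \<Rightarrow> infinite_word \<Rightarrow> bool" where
  "at_most_spacer_rank n V \<longleftrightarrow>
     (\<exists>(N :: nat \<Rightarrow> nat) (v :: nat \<Rightarrow> nat \<Rightarrow> word) (S :: nat \<Rightarrow> word set).
        (\<forall>i. 1 \<le> N i \<and> N i \<le> n) \<and>
        (\<forall>i. S i = v i ` {1..N i} \<and> S i \<subseteq> \<F>) \<and>
        (\<forall>j \<in> {1..N 0}. v 0 j = [0]) \<and>
        (\<forall>i. built_from_starting_with (S i) (v i 1) (v (i + 1) 1)) \<and>
        (\<forall>i. \<forall>j \<in> {2..N (i + 1)}. built_from (S i) (v (i + 1) j)) \<and>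
        (\<forall>i. initial_segment (v i 1) V))"

definition spacer_rank :: "nat \<Rightarrow> infinite_word \<Rightarrow> bool" where
  "spacer_rank n V \<longleftrightarrow>
     at_most_spacer_rank n V \<and> (n > 1 \<longrightarrow> \<not> at_most_spacer_rank (n - 1) V)"

text \<open>
  In a proper construction the words \<open>v i 1, \<dots>, v i n\<close> are distinct for \<open>i \<ge> 1\<close>, and
  every \<open>v (i + 1) j\<close> has a single building that uses all of \<open>S\<^sub>i\<close> and, for \<open>j = 1\<close>, also
  starts with \<open>v i 1\<close>.
\<close>

definition proper_spacer_rank :: "nat \<Rightarrow> infinite_word \<Rightarrow> bool" where
  "proper_spacer_rank n V \<longleftrightarrow>
     (n > 1 \<longrightarrow> \<not> at_most_spacer_rank (n - 1) V) \<and>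
     (\<exists>(v :: nat \<Rightarrow> nat \<Rightarrow> word) (S :: nat \<Rightarrow> word set).
        S 0 = {[0]} \<and> (\<forall>j \<in> {1..n}. v 0 j = [0]) \<and>
        (\<forall>i \<ge> 1. S i = v i ` {1..n} \<and> S i \<subseteq> \<F> \<and> card (S i) = n) \<and>
        (\<forall>i. \<exists>vs as. building (S i) (v (i + 1) 1) vs as \<and> hd vs = v i 1 \<and> set vs = S i) \<and>
        (\<forall>i. \<forall>j \<in> {2..n}. \<exists>vs as. building (S i) (v (i + 1) j) vs as \<and> set vs = S i) \<and>
        (\<forall>i. initial_segment (v i 1) V))"

end

theory Submission
  imports Defs "HOL-Library.Nat_Bijection" "HOL-Library.Sublist"
begin

text \<open>
  A word starting and ending with \<open>0\<close> is determined by the list of its gaps, the numbers of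
  \<open>1\<close>s between consecutive \<open>0\<close>s. Let \<open>N = n + 1\<close>, and let the \<open>j\<close>-th word of level \<open>i + 1\<close> be
  \<open>v\<^sub>1 1^a v\<^sub>2 1^a \<dots> 1^a v\<^sub>N\<close>, where \<open>v\<^sub>1, \<dots>, v\<^sub>N\<close> are the words of level \<open>i\<close> and the gap \<open>a\<close> is
  different for every pair \<open>(i, j)\<close>. Suppose that the limit \<open>V\<close> also decomposes over a finite set \<open>S\<close>
  not containing \<open>0\<close>. The words of a level with large gaps all decompose over \<open>S\<close>, while
  those of level \<open>0\<close> do not, so there is an \<open>i\<close> such that all words of level \<open>i + 1\<close> decompose
  over \<open>S\<close> but not all words of level \<open>i\<close> do. Then for each \<open>j\<close> the gap of \<open>(i, j)\<close> must occur
  inside some member of \<open>S\<close> that is a factor of the \<open>j\<close>-th word of level \<open>i + 1\<close>, and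
  these \<open>N\<close> members of \<open>S\<close> are distinct.
\<close>

section \<open>Gap lists\<close>

fun word_of_gaps :: "nat list \<Rightarrow> word" where
  "word_of_gaps [] = [0]"
| "word_of_gaps (b # bs) = 0 # replicate b 1 @ word_of_gaps bs"

lemma word_of_gaps_append:
  "word_of_gaps (xs @ a # ys) = word_of_gaps xs @ replicate a 1 @ word_of_gaps ys"
  by (induction xs) auto

lemma word_of_gaps_neq_Nil [simp]: "word_of_gaps xs \<noteq> []"
  by (cases xs) auto

lemma hd_word_of_gaps [simp]: "hd (word_of_gaps xs) = 0"
  by (cases xs) auto

lemma last_word_of_gaps [simp]: "last (word_of_gaps xs) = 0"
  by (induction xs) auto

lemma word_of_gaps_in_zero_words: "word_of_gaps xs \<in> \<F>"
  by (simp add: zero_words_def)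

lemma length_less_length_word_of_gaps: "length xs < length (word_of_gaps xs)"
  by (induction xs) auto

lemma ones_then_zero_prefix_eq:
  assumes "prefix (replicate b 1 @ u) (replicate c (1::bit) @ w)"
    and "u \<noteq> []" "hd u = 0" "hd w = 0"
  shows "b = c \<and> prefix u w"
  using assms(1)
proof (induction b arbitrary: c)
  case 0
  then show ?case using assms(2,3) by (cases c; cases u) auto
next
  case (Suc b)
  then show ?case using assms(2-4) by (cases c; cases w) auto
qed

text \<open>The last \<open>0\<close> of \<open>word_of_gaps xs\<close> closes its last gap, so the
  prefix cannot end in the middle of a gap of the longer word.\<close>

lemma prefix_of_prefix_word_of_gaps:
  "prefix (word_of_gaps xs) (word_of_gaps ys) \<Longrightarrow> prefix xs ys"
proof (induction xs arbitrary: ys)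
  case (Cons b bs)
  then show ?case
  proof (cases ys)
    case Nil
    with Cons.prems show ?thesis by simp
  next
    case [simp]: (Cons c cs)
    have "prefix (replicate b 1 @ word_of_gaps bs) (replicate c 1 @ word_of_gaps cs)"
      using Cons.prems by simp
    then have "b = c \<and> prefix (word_of_gaps bs) (word_of_gaps cs)"
      by (rule ones_then_zero_prefix_eq) simp_all
    then show ?thesis using Cons.IH by simp
  qed
qed simp

lemma inj_word_of_gaps: "inj word_of_gaps"
  by (rule injI) (metis prefix_of_prefix_word_of_gaps prefix_order.antisym prefix_order.refl)

lemma zero_words_eq_range: "\<F> = range word_of_gaps"
proof (rule antisym)
  \<comment> \<open>Deleting the first letter can leave a leading block of ones, so the induction
    covers all words ending in \<open>0\<close>. The block is empty once the word also starts with
    \<open>0\<close>.\<close>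
  have ex: "last w = 0 \<Longrightarrow> w \<noteq> [] \<Longrightarrow> \<exists>a xs. w = replicate a 1 @ word_of_gaps xs" for w :: word
  proof (induction w)
    case (Cons c w)
    show ?case
    proof (cases "w = []")
      case True
      with Cons.prems have "c # w = replicate 0 1 @ word_of_gaps []" by simp
      then show ?thesis by blast
    next
      case False
      with Cons obtain a xs where w: "w = replicate a 1 @ word_of_gaps xs" by auto
      show ?thesis
      proof (cases c)
        case zero
        then have "c # w = replicate 0 1 @ word_of_gaps (a # xs)" using w by simp
        then show ?thesis by blast
      next
        case one
        then have "c # w = replicate (Suc a) 1 @ word_of_gaps xs" using w by simp
        then show ?thesis by blast
      qed
    qed
  qed simp
  show "\<F> \<subseteq> range word_of_gaps"
  proof
    fix w assume "w \<in> \<F>"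
    then have w: "w \<noteq> []" "hd w = 0" "last w = 0" by (auto simp: zero_words_def)
    then obtain a xs where eq: "w = replicate a 1 @ word_of_gaps xs" using ex by blast
    with w(2) have "a = 0" by (cases a) auto
    with eq show "w \<in> range word_of_gaps" by simp
  qed
qed (use word_of_gaps_in_zero_words in auto)

section \<open>Buildings in terms of gap lists\<close>

definition glue :: "'a list \<Rightarrow> 'a list \<Rightarrow> 'a list list \<Rightarrow> 'a list" where
  "glue x as xs = x @ concat (map2 (#) as xs)"

lemma length_less_length_glue:
  "as \<noteq> [] \<Longrightarrow> length as = length xs \<Longrightarrow> length x < length (glue x as xs)"
  by (cases as; cases xs) (auto simp: glue_def)

lemma word_of_gaps_glue:
  assumes "length as = length xs"
  shows "word_of_gaps (glue x as xs) =
    concat (map2 (\<lambda>v a. v @ replicate a 1) (butlast (map word_of_gaps (x # xs))) as)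
      @ last (map word_of_gaps (x # xs))"
  using assms
proof (induction as xs arbitrary: x rule: list_induct2)
  case (Cons a as y ys)
  have "glue x (a # as) (y # ys) = x @ a # glue y as ys" by (simp add: glue_def)
  then show ?case using Cons.IH[of y] by (simp add: word_of_gaps_append)
qed (simp add: glue_def)

text \<open>A spacer stands between two zeros, so it contributes exactly one entry to the gap list,
  even when it is empty; \<open>glue\<close> inserts these entries. The condition
  \<open>as \<noteq> []\<close> is \<open>k \<ge> 1\<close>. Injectivity of
  \<open>word_of_gaps\<close> carries the equation of words back to gap lists.\<close>

lemma building_word_of_gaps_iff:
  "building (word_of_gaps ` S) (word_of_gaps w) vs as \<longleftrightarrow>
    (\<exists>x xs. vs = map word_of_gaps (x # xs) \<and> insert x (set xs) \<subseteq> S \<and> as \<noteq> [] \<and>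
      length as = length xs \<and> w = glue x as xs)"
proof
  assume b: "building (word_of_gaps ` S) (word_of_gaps w) vs as"
  then have "set vs \<subseteq> word_of_gaps ` S" "length vs = Suc (length as)" "as \<noteq> []"
    by (auto simp: building_def)
  then obtain zs where zs: "set zs \<subseteq> S" "vs = map word_of_gaps zs"
    using lists_image[of word_of_gaps S] unfolding lists_eq_set by blast
  with b obtain x xs where "zs = x # xs"
    by (cases zs) (auto simp: building_def)
  with b zs word_of_gaps_glue[of as xs x] show "\<exists>x xs. vs = map word_of_gaps (x # xs) \<and>
      insert x (set xs) \<subseteq> S \<and> as \<noteq> [] \<and> length as = length xs \<and> w = glue x as xs"
    by (intro exI[of _ x] exI[of _ xs])
      (auto simp: building_def intro: injD[OF inj_word_of_gaps])
next
  assume "\<exists>x xs. vs = map word_of_gaps (x # xs) \<and> insert x (set xs) \<subseteq> S \<and> as \<noteq> [] \<and>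
      length as = length xs \<and> w = glue x as xs"
  then obtain x xs where "vs = map word_of_gaps (x # xs)" "set (x # xs) \<subseteq> S" "as \<noteq> []"
      "length as = length xs" "w = glue x as xs" by auto
  then show "building (word_of_gaps ` S) (word_of_gaps w) vs as"
    using word_of_gaps_glue[of as xs x] image_mono[of "set (x # xs)" S word_of_gaps]
    unfolding building_def by (auto simp: Suc_le_eq)
qed

section \<open>Decompositions over a set of gap lists\<close>

text \<open>Separators are arbitrary. Unlike in a building, a single member counts, so that
  \<open>S\<close> lies in \<open>chains S\<close>.\<close>

inductive_set chains :: "'a list set \<Rightarrow> 'a list set" for S where
  single: "x \<in> S \<Longrightarrow> x \<in> chains S"
| cons: "x \<in> S \<Longrightarrow> w \<in> chains S \<Longrightarrow> x @ a # w \<in> chains S"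

lemma chains_append: "u \<in> chains S \<Longrightarrow> w \<in> chains S \<Longrightarrow> u @ a # w \<in> chains S"
  by (induction rule: chains.induct) (auto intro: chains.intros)

lemma glue_in_chains:
  assumes "length as = length xs" "insert x (set xs) \<subseteq> chains S"
  shows "glue x as xs \<in> chains S"
  using assms
proof (induction as xs arbitrary: x rule: list_induct2)
  case (Cons a as y ys)
  have "glue x (a # as) (y # ys) = x @ a # glue y as ys" by (simp add: glue_def)
  then show ?case using Cons by (auto intro: chains_append)
qed (simp add: glue_def)

lemma Nil_notin_chains: "[] \<notin> S \<Longrightarrow> [] \<notin> chains S"
  by (auto elim: chains.cases)

text \<open>An occurrence of \<open>a\<close> is a separator or lies inside a member of
  \<open>S\<close>. A member that is used has all its entries in the whole list, so the second
  assumption leaves only separators, and the decomposition can be cut there.\<close>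

lemma chains_split:
  assumes "u @ a # w \<in> chains S"
    and "\<And>x. x \<in> S \<Longrightarrow> a \<in> set x \<Longrightarrow> \<not> set x \<subseteq> set (u @ a # w)"
  shows "u \<in> chains S \<and> w \<in> chains S"
  using assms
proof (induction "u @ a # w" arbitrary: u rule: chains.induct)
  case single
  then show ?case by fastforce
next
  case (cons x z b)
  \<comment> \<open>The marked \<open>a\<close> lies inside the first member \<open>x\<close>, is
    the separator \<open>b\<close>, or lies in the rest \<open>z\<close>.\<close>
  from cons.hyps(4) consider c where "x = u @ a # c"
    | "x = u" "b = a" "z = w"
    | c where "u = x @ b # c" "z = c @ a # w"
    by (auto simp: append_eq_append_conv2 append_eq_Cons_conv Cons_eq_append_conv)
  then show ?case
  proof cases
    case 1
    then show ?thesis using cons.prems[of x] cons.hyps by force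
  next
    case 2
    then show ?thesis using cons.hyps by (auto intro: chains.single)
  next
    case 3
    have "c \<in> chains S \<and> w \<in> chains S"
      using 3 cons.prems by (intro cons.hyps(3)) auto
    then show ?thesis using 3 cons.hyps(1) by (auto intro: chains.cons)
  qed
qed

text \<open>Cut at the separators from left to right. The second assumption passes to the tail,
  whose entries are among those of the whole list.\<close>

lemma chains_glue_split:
  assumes "glue x (replicate (length xs) a) xs \<in> chains S"
    and "\<And>y. y \<in> S \<Longrightarrow> a \<in> set y \<Longrightarrow> \<not> set y \<subseteq> set (glue x (replicate (length xs) a) xs)"
  shows "insert x (set xs) \<subseteq> chains S"
  using assms
proof (induction xs arbitrary: x)
  case (Cons y ys)
  have eq: "glue x (replicate (length (y # ys)) a) (y # ys)
      = x @ a # glue y (replicate (length ys) a) ys" by (simp add: glue_def)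
  have "x \<in> chains S \<and> glue y (replicate (length ys) a) ys \<in> chains S"
    using Cons.prems unfolding eq by (rule chains_split)
  moreover from this have "insert y (set ys) \<subseteq> chains S"
    using Cons.prems(2) unfolding eq by (intro Cons.IH) auto
  ultimately show ?case by simp
qed (simp add: glue_def)

section \<open>The construction\<close>

text \<open>\<open>prod_encode\<close> supplies the distinct gaps. Word 1 comes first, so that the
  first words of successive levels are nested.\<close>

fun level_word :: "nat \<Rightarrow> nat \<Rightarrow> nat \<Rightarrow> nat list" where
  "level_word n 0 j = []"
| "level_word n (Suc i) j =
    glue (level_word n i 1) (replicate n (prod_encode (i, j))) (map (level_word n i) [2..<n + 2])"

lemma level_word_Suc_prefix:
  assumes "n \<ge> 1"
  shows "prefix (level_word n i 1 @ [prod_encode (i, j)]) (level_word n (Suc i) j)"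
proof -
  obtain m where "n = Suc m" using assms by (cases n) auto
  then show ?thesis by (simp add: glue_def upt_rec[of 2])
qed

lemma set_level_word_Suc:
  assumes "n \<ge> 1"
  shows "set (level_word n (Suc i) j)
    = insert (prod_encode (i, j)) (\<Union>k\<in>{1..n + 1}. set (level_word n i k))"
proof -
  have glue: "set (glue x (replicate (length xs) a) xs)
      = set x \<union> (if xs = [] then {} else insert a (\<Union>y\<in>set xs. set y))" for x xs and a :: nat
  proof (induction xs arbitrary: x)
    case (Cons y ys)
    have "glue x (replicate (length (y # ys)) a) (y # ys)
      = x @ a # glue y (replicate (length ys) a) ys" by (simp add: glue_def)
    then show ?case by (auto simp: Cons.IH)
  qed (simp add: glue_def)
  have "{1..n + 1} = insert 1 {2..<n + 2}" by auto
  then show ?thesis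
    using assms glue[of "level_word n i 1" "map (level_word n i) [2..<n + 2]" "prod_encode (i, j)"]
    by (simp del: upt_Suc)
qed

lemma gap_in_level_wordD:
  assumes "n \<ge> 1" "b \<in> set (level_word n i j)"
  shows "fst (prod_decode b) < i"
  using assms(2)
proof (induction i arbitrary: j)
  case (Suc i)
  then show ?case using set_level_word_Suc[OF assms(1)] less_SucI by fastforce
qed simp

text \<open>Gaps inherited from level \<open>i\<close> have first component below \<open>i\<close>,
  so this gap is new and identifies the word within its level.\<close>

lemma level_gap_in_level_word_iff:
  assumes "n \<ge> 1"
  shows "prod_encode (i, j) \<in> set (level_word n (Suc i) k) \<longleftrightarrow> j = k"
  using gap_in_level_wordD[OF assms, of "prod_encode (i, j)" i]
  by (auto simp: set_level_word_Suc[OF assms] simp del: level_word.simps)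

lemma inj_level_word: "n \<ge> 1 \<Longrightarrow> inj (level_word n (Suc i))"
  by (rule injI) (metis level_gap_in_level_word_iff)

lemma level_words_in_chains:
  assumes "n \<ge> 1" "level_word n (Suc i) j \<in> chains S"
    and "\<And>y. y \<in> S \<Longrightarrow> prod_encode (i, j) \<in> set y \<Longrightarrow> \<not> set y \<subseteq> set (level_word n (Suc i) j)"
  shows "level_word n i ` {1..n + 1} \<subseteq> chains S"
proof -
  have "insert (level_word n i 1) (set (map (level_word n i) [2..<n + 2])) \<subseteq> chains S"
    using assms by (intro chains_glue_split[where a = "prod_encode (i, j)"]) (auto simp del: upt_Suc)
  moreover have "{1..n + 1} = insert 1 {2..<n + 2}" by auto
  ultimately show ?thesis by (simp del: upt_Suc)
qed

lemma card_gt_if_level_word_in_chains: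
  assumes "n \<ge> 1" "finite S" "[] \<notin> S"
    and unbounded: "\<And>i. \<exists>y \<in> chains S. prefix (level_word n i 1) y"
  shows "card S > n"
proof -
  define P where "P i \<longleftrightarrow> level_word n i ` {1..n + 1} \<subseteq> chains S" for i
  \<comment> \<open>All entries of members of \<open>S\<close> are below \<open>i\<close>, and
    \<open>prod_encode (k, 1) \<ge> k\<close>, so for \<open>k \<ge> i\<close> this gap occurs in no
    member.\<close>
  have "finite (\<Union>x\<in>S. set x)" using assms(2) by simp
  then obtain i where i: "\<forall>b \<in> (\<Union>x\<in>S. set x). b < i"
    using finite_nat_set_iff_bounded by blast
  have large: "prod_encode (k, 1) \<notin> set x" if "k \<ge> i" "x \<in> S" for k x
    using i that le_prod_encode_1[of k 1] by fastforce
  \<comment> \<open>Word 1 of level \<open>i + 2\<close> begins with word 1 of level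
    \<open>i + 1\<close> followed by the gap of \<open>(i + 1, 1)\<close>. Cutting \<open>y\<close>
    there puts word 1 of level \<open>i + 1\<close> into \<open>chains S\<close>; cutting that word
    at the gap of \<open>(i, 1)\<close> gives \<open>P i\<close>.\<close>
  obtain y where y: "y \<in> chains S" "prefix (level_word n (Suc (Suc i)) 1) y"
    using unbounded by blast
  then obtain z where "y = level_word n (Suc i) 1 @ prod_encode (Suc i, 1) # z"
    using prefix_order.trans[OF level_word_Suc_prefix[OF assms(1)]]
    by (fastforce simp del: level_word.simps simp: prefix_def)
  with y have "level_word n (Suc i) 1 \<in> chains S"
    using chains_split large[of "Suc i"] by (metis le_SucI order_refl)
  then have "P i"
    unfolding P_def using large[of i] assms(1) by (intro level_words_in_chains[where j = 1]) auto
  moreover have "\<not> P 0"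
    using Nil_notin_chains[OF assms(3)] by (auto simp: P_def image_constant_conv)
  ultimately obtain i where i: "\<not> P i" "P (Suc i)"
    by (induction i) auto
  \<comment> \<open>Without such a member, cutting word \<open>j\<close> of level
    \<open>i + 1\<close> at its new gap would give \<open>P i\<close>.\<close>
  have "\<exists>x. x \<in> S \<and> prod_encode (i, j) \<in> set x \<and> set x \<subseteq> set (level_word n (Suc i) j)"
    if "j \<in> {1..n + 1}" for j
    using level_words_in_chains[OF assms(1), of i j S] i that by (force simp: P_def)
  then obtain f where f: "\<And>j. j \<in> {1..n + 1} \<Longrightarrow> f j \<in> S \<and> prod_encode (i, j) \<in> set (f j) \<and>
      set (f j) \<subseteq> set (level_word n (Suc i) j)"
    by metis
  have "inj_on f {1..n + 1}"
  proof (rule inj_onI)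
    fix j k assume "j \<in> {1..n + 1}" "k \<in> {1..n + 1}" "f j = f k"
    \<comment> \<open>The common value contains the gap of \<open>(i, j)\<close>, and all its
      entries occur in word \<open>k\<close>.\<close>
    then have "prod_encode (i, j) \<in> set (level_word n (Suc i) k)"
      using f[of j] f[of k] by auto
    then show "j = k" using level_gap_in_level_word_iff[OF assms(1)] by blast
  qed
  moreover have "f ` {1..n + 1} \<subseteq> S" using f by blast
  ultimately have "card {1..n + 1} \<le> card S"
    using card_inj_on_le assms(2) by blast
  then show ?thesis by simp
qed

section \<open>The limit word and its initial segments\<close>

definition limit_word :: "nat \<Rightarrow> infinite_word" where
  "limit_word n m = word_of_gaps (level_word n m 1) ! m"

lemma level_word_mono:
  assumes "n \<ge> 1" "i \<le> k"
  shows "prefix (word_of_gaps (level_word n i 1)) (word_of_gaps (level_word n k 1))"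
  using assms(2)
proof (induction rule: dec_induct)
  case (step k)
  obtain z where "level_word n (Suc k) 1 = level_word n k 1 @ prod_encode (k, 1) # z"
    using level_word_Suc_prefix[OF assms(1), of k 1]
    by (auto simp: prefix_def simp del: level_word.simps)
  then show ?case using step.IH
    by (simp add: word_of_gaps_append del: level_word.simps)
qed simp

lemma length_level_word: "n \<ge> 1 \<Longrightarrow> i \<le> length (level_word n i 1)"
proof (induction i)
  case (Suc i)
  then show ?case
    using prefix_length_le[OF level_word_Suc_prefix[of n i 1]] by (simp del: level_word.simps)
qed simp

lemma initial_segment_limit_word:
  assumes "n \<ge> 1"
  shows "initial_segment (word_of_gaps (level_word n i 1)) (limit_word n)"
  unfolding initial_segment_def limit_word_def
proof (intro allI impI)
  fix m assume m: "m < length (word_of_gaps (level_word n i 1))"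
  \<comment> \<open>The diagonal definition never reads past the end: the gap list at level
    \<open>m\<close> has at least \<open>m\<close> entries, and its word is strictly longer.\<close>
  have m': "m < length (word_of_gaps (level_word n m 1))"
    using length_level_word[OF assms, of m]
      length_less_length_word_of_gaps[of "level_word n m 1"] by linarith
  show "word_of_gaps (level_word n i 1) ! m = word_of_gaps (level_word n m 1) ! m"
    using level_word_mono[OF assms, of i m] level_word_mono[OF assms, of m i] m m'
    by (cases "i \<le> m") (auto simp: prefix_def nth_append)
qed

section \<open>No construction of the limit word with at most \<open>n\<close> words per
  level\<close>

lemma prefix_if_initial_segments:
  assumes "initial_segment u V" "initial_segment w V" "length u \<le> length w"
  shows "prefix u w"
proof -
  have "take (length u) w = u"
    using assms by (intro nth_equalityI) (auto simp: initial_segment_def)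
  then show ?thesis by (metis take_is_prefix)
qed

text \<open>The counting bound is applied to level 1 of the supposed construction, read as gap
  lists. Its words come from buildings with \<open>k \<ge> 1\<close>, so none has an empty gap list,
  and all later levels decompose over them.\<close>

lemma not_at_most_spacer_rank_limit_word:
  assumes "n \<ge> 1"
  shows "\<not> at_most_spacer_rank n (limit_word n)"
proof
  assume "at_most_spacer_rank n (limit_word n)"
  then obtain N v and S :: "nat \<Rightarrow> word set" where
    NS: "\<forall>i. 1 \<le> N i \<and> N i \<le> n" "\<forall>i. S i = v i ` {1..N i} \<and> S i \<subseteq> \<F>" and
    first: "\<forall>i. built_from_starting_with (S i) (v i 1) (v (i + 1) 1)" and
    others: "\<forall>i. \<forall>j \<in> {2..N (i + 1)}. built_from (S i) (v (i + 1) j)" and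
    seg: "\<forall>i. initial_segment (v i 1) (limit_word n)"
    unfolding at_most_spacer_rank_def by blast
  have N: "1 \<le> N i" "N i \<le> n" and S: "S i = v i ` {1..N i}" "S i \<subseteq> \<F>" for i
    using NS by blast+
  define y where "y i j = inv word_of_gaps (v i j)" for i j
  define T where "T i = y i ` {1..N i}" for i
  have v: "v i j = word_of_gaps (y i j)" if "j \<in> {1..N i}" for i j
  proof -
    have "v i j \<in> range word_of_gaps"
      using that S[of i] unfolding zero_words_eq_range by blast
    then show ?thesis by (simp add: y_def f_inv_into_f)
  qed
  have ST: "S i = word_of_gaps ` T i" for i
    unfolding S T_def image_image using v by (intro image_cong) auto
  have built: "\<exists>x as xs. y (Suc i) j = glue x as xs \<and> as \<noteq> [] \<and> length as = length xs \<and>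
      insert x (set xs) \<subseteq> T i \<and> (j = 1 \<longrightarrow> x = y i 1)" if j: "j \<in> {1..N (Suc i)}" for i j
  proof -
    obtain vs as where vs: "building (S i) (v (Suc i) j) vs as" "j = 1 \<longrightarrow> hd vs = v i 1"
    proof (cases "j = 1")
      case True
      then show ?thesis using spec[OF first, of i] that by (auto simp: built_from_starting_with_def)
    next
      case False
      with j have "j \<in> {2..N (i + 1)}" by auto
      then show ?thesis
        using others that False unfolding built_from_def Suc_eq_plus1 by blast
    qed
    then obtain x xs where "vs = map word_of_gaps (x # xs)" "insert x (set xs) \<subseteq> T i" "as \<noteq> []"
        "length as = length xs" "y (Suc i) j = glue x as xs"
      unfolding ST v[OF j] building_word_of_gaps_iff by blast
    moreover from this have "x = y i 1" if "j = 1"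
      using vs(2) v[of 1 i] N(1)[of i] that by (auto intro: injD[OF inj_word_of_gaps])
    ultimately show ?thesis by blast
  qed
  have T1: "finite (T 1)" "card (T 1) \<le> n"
    using card_image_le[of "{1..N 1}" "y 1"] N(2)[of 1] by (auto simp: T_def)
  have "[] \<notin> T 1"
  proof
    assume "[] \<in> T 1"
    then obtain j where j: "j \<in> {1..N (Suc 0)}" "y (Suc 0) j = []" by (auto simp: T_def)
    obtain x as xs where "y (Suc 0) j = glue x as xs" "as \<noteq> []" "length as = length xs"
      using built[OF j(1)] by blast
    then show False using length_less_length_glue j(2) by (metis length_0_conv not_less0)
  qed
  have T_chains: "T (Suc i) \<subseteq> chains (T 1)" for i
  proof (induction i)
    case 0
    then show ?case by (auto intro: chains.single)
  next
    case (Suc i)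
    show ?case
    proof
      fix z assume "z \<in> T (Suc (Suc i))"
      then obtain j where j: "j \<in> {1..N (Suc (Suc i))}" "z = y (Suc (Suc i)) j"
        unfolding T_def by blast
      then obtain x as xs where z: "z = glue x as xs" "length as = length xs"
          "insert x (set xs) \<subseteq> T (Suc i)"
        using built[OF j(1)] by blast
      show "z \<in> chains (T 1)"
        unfolding z(1) using z(2) subset_trans[OF z(3) Suc] by (rule glue_in_chains)
    qed
  qed
  \<comment> \<open>A building extends its starting word by at least one gap.\<close>
  have len: "i \<le> length (y i 1)" for i
  proof (induction i)
    case (Suc i)
    obtain as xs where "y (Suc i) 1 = glue (y i 1) as xs" "as \<noteq> []" "length as = length xs"
      using built[of 1 i] N(1)[of "Suc i"] by auto
    then show ?case using Suc length_less_length_glue[of as xs "y i 1"] by simp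
  qed simp
  have "\<exists>z \<in> chains (T 1). prefix (level_word n i 1) z" for i
  proof
    \<comment> \<open>At this level \<open>v k 1\<close> is at least as long as the given word, and
      both are initial segments of the limit. The successor ensures \<open>k \<ge> 1\<close>, where
      \<open>T k\<close> lies in \<open>chains (T 1)\<close>.\<close>
    define k where "k = Suc (length (word_of_gaps (level_word n i 1)))"
    have N1: "1 \<in> {1..N k}" using N(1) by simp
    show "y k 1 \<in> chains (T 1)"
      using T_chains[of "length (word_of_gaps (level_word n i 1))"] N1
      by (auto simp: k_def T_def)
    have "length (word_of_gaps (level_word n i 1)) \<le> length (v k 1)"
      using len[of k] length_less_length_word_of_gaps[of "y k 1"] v[OF N1] by (simp add: k_def)
    then have "prefix (word_of_gaps (level_word n i 1)) (v k 1)"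
      using prefix_if_initial_segments initial_segment_limit_word[OF assms] seg by blast
    then show "prefix (level_word n i 1) (y k 1)"
      using v[OF N1] by (simp add: prefix_of_prefix_word_of_gaps)
  qed
  then have "card (T 1) > n"
    using card_gt_if_level_word_in_chains[OF assms] T1(1) \<open>[] \<notin> T 1\<close> by blast
  with T1(2) show False by simp
qed

section \<open>The proper construction with \<open>n + 1\<close> words per level\<close>

lemma building_level_word:
  assumes "n \<ge> 1"
  defines "v \<equiv> \<lambda>i j. word_of_gaps (level_word n i j)"
  shows "\<exists>vs as. building (v i ` {1..n + 1}) (v (Suc i) j) vs as \<and> hd vs = v i 1 \<and>
    set vs = v i ` {1..n + 1}"
proof -
  let ?xs = "map (level_word n i) [2..<n + 2]" and ?as = "replicate n (prod_encode (i, j))"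
  have I: "{1..n + 1} = insert 1 {2..<n + 2}" by auto
  have v: "v i ` {1..n + 1} = word_of_gaps ` level_word n i ` {1..n + 1}"
    by (simp add: v_def image_image)
  have "building (v i ` {1..n + 1}) (v (Suc i) j)
      (map word_of_gaps (level_word n i 1 # ?xs)) ?as"
    unfolding v unfolding v_def building_word_of_gaps_iff using assms(1)
    by (intro exI[of _ "level_word n i 1"] exI[of _ ?xs]) (auto simp: I simp del: upt_Suc)
  moreover have "set (map word_of_gaps (level_word n i 1 # ?xs)) = v i ` {1..n + 1}"
    unfolding I by (simp add: v_def image_image del: upt_Suc)
  ultimately show ?thesis by (intro exI conjI) (auto simp: v_def)
qed

theorem proposition2p5:
  fixes n :: nat
  assumes "n \<ge> 1"
  shows "\<exists>V :: infinite_word. proper_spacer_rank (n + 1) V \<and> \<not> spacer_rank n V"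
proof (intro exI conjI)
  define v where "v i j = word_of_gaps (level_word n i j)" for i j
  define S where "S i = v i ` {1..n + 1}" for i
  have "S 0 = {[0]}"
    by (auto simp: S_def v_def)
  moreover have "\<forall>j \<in> {1..n + 1}. v 0 j = [0]" by (simp add: v_def)
  \<comment> \<open>From level 1 on the new gaps make the words distinct; at level 0 they all
    coincide.\<close>
  moreover have "card (S i) = n + 1" if "i \<ge> 1" for i
  proof -
    obtain k where "i = Suc k" using \<open>i \<ge> 1\<close> by (cases i) auto
    then have "inj (v i)"
      unfolding v_def using inj_compose[OF inj_word_of_gaps inj_level_word[OF assms, of k]]
      by (simp add: o_def)
    then show ?thesis by (simp add: S_def card_image inj_on_subset)
  qed
  moreover have "S i \<subseteq> \<F>" for i
    by (auto simp: S_def v_def word_of_gaps_in_zero_words)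
  moreover have
    "\<exists>vs as. building (S i) (v (i + 1) j) vs as \<and> hd vs = v i 1 \<and> set vs = S i" for i j
    unfolding S_def v_def using building_level_word[OF assms, of i j] by simp
  moreover from this have "\<exists>vs as. building (S i) (v (i + 1) j) vs as \<and> set vs = S i" for i j
    by blast
  moreover have "initial_segment (v i 1) (limit_word n)" for i
    unfolding v_def by (rule initial_segment_limit_word[OF assms])
  \<comment> \<open>Since \<open>n + 1 - 1 = n\<close>, the lower bound required here is the same
    fact that rules out \<open>spacer_rank n\<close>.\<close>
  ultimately show "proper_spacer_rank (n + 1) (limit_word n)"
    unfolding proper_spacer_rank_def
    using not_at_most_spacer_rank_limit_word[OF assms]
    by (intro conjI exI[of _ v] exI[of _ S]) (simp_all add: S_def)
  show "\<not> spacer_rank n (limit_word n)"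
    using not_at_most_spacer_rank_limit_word[OF assms] by (simp add: spacer_rank_def)
qed

end
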